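(* Let the objective $\varphi$ of the problem $(P_2)$ have Hölder-continuous subgradient, i.e. $\|\nabla\varphi(\lambda)-\nabla\varphi(\mu)\|_2\le M_\nu\|\lambda-\mu\|_2^\nu$ for all $\lambda,\mu\in\Lambda$ and some $\nu\in[0,1]$, and let the solution of this problem be bounded, i.e. $\|\lambda^*\|_2\le R$. Then, for the sequence $\hat x^{k+1},\eta^{k+1}$, $k\ge0$, generated by the algorithm PDUGDsDR described in the context (with parameter $\varepsilon>0$), for all $k\ge1$, $$\|\mathbf{A}\hat x^k-b\|_2\le\frac{2R}{A_k}+\frac\varepsilon{2R},\qquad|\varphi(\eta^k)+f(\hat x^k)|\le\frac{2R^2}{A_k}+\frac\varepsilon2,$$ where $$A_k\ge\left[\frac{1+\nu}{1-\nu}\right]^{\frac{1-\nu}{1+\nu}}\frac{k^{\frac{1+3\nu}{1+\nu}}\varepsilon^{\frac{1-\nu}{1+\nu}}}{2^{\frac{1+3\nu}{1+\nu}}M_\nu^{\frac2{1+\nu}}}$$ (for $\nu=1$ the first factor is understood as its limit, $1$).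
   Context: Primal problem $(P_1)$: $\min_{x\in Q\subseteq E}\{f(x):\mathbf{A}x=b\}$, $E,H$ finite-dimensional real vector spaces, $Q$ a simple closed convex set, $f$ convex, $\mathbf{A}:E\to H$ linear, $b\in H$. Dual in minimization form, $(P_2)$: $\min_{\lambda\in\Lambda}\varphi(\lambda)$, $\Lambda=H^*$, $\varphi(\lambda)=\langle\lambda,b\rangle+\max_{x\in Q}(-f(x)-\langle\mathbf{A}^T\lambda,x\rangle)$. Its subgradient is $\nabla\varphi(\lambda)=b-\mathbf{A}x(\lambda)$, where $x(\lambda)$ is some solution of $\max_{x\in Q}(-f(x)-\langle\mathbf{A}^T\lambda,x\rangle)$. $(P_2)$ has a solution $\lambda^*$. The dual space carries the Euclidean norm $\|\cdot\|_2$. PDUGDsDR: $A_0=0$, $\eta^0=\zeta^0=\lambda^0=0$. For $k=0,1,\dots$: 1. $\beta_k=\arg\min_{\beta\in[0,1]}\varphi(\zeta^k+\beta(\eta^k-\zeta^k))$; $\lambda^k=\zeta^k+\beta_k(\eta^k-\zeta^k)$; 2. choose the subgradient $\nabla\varphi(\lambda^k)=b-\mathbf{A}x(\lambda^k)$ so that $\langle\nabla\varphi(\lambda^k),\zeta^k-\lambda^k\rangle\ge0$; $h_{k+1}=\arg\min_{h\ge0}\varphi(\lambda^k-h\nabla\varphi(\lambda^k))$; $\eta^{k+1}=\lambda^k-h_{k+1}\nabla\varphi(\lambda^k)$; 3. choose $a_{k+1}$ (the largest root) from $\varphi(\eta^{k+1})=\varphi(\lambda^k)-\frac{a_{k+1}^2}{2A_{k+1}}\|\nabla\varphi(\lambda^k)\|_2^2+\frac{\varepsilon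 a_{k+1}}{2A_{k+1}}$, where $A_{k+1}=A_k+a_{k+1}$; 4. $\zeta^{k+1}=\zeta^k-a_{k+1}\nabla\varphi(\lambda^k)$; 5. $\hat x^{k+1}=\frac1{A_{k+1}}\sum_{i=0}^ka_{i+1}x(\lambda^i)=\frac{a_{k+1}x(\lambda^k)+A_k\hat x^k}{A_{k+1}}$. (The method is stopped once $|f(\hat x^{k+1})+\varphi(\eta^{k+1})|$ and $\|\mathbf{A}\hat x^{k+1}-b\|_2$ are below given tolerances.)
   Formalization: The lower bound on A_k is claimed only when the subgradients ∇φ(λ^i), i<k, used so far are nonzero; if one vanishes, then a_{i+1}=0, A stays constant and the bound fails as k grows. The two error bounds need no such condition. *)

theory Defs
  imports "HOL-Analysis.Analysis"
begin

(* E and H are types of class euclidean_space; their duals are identified with them through the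
   inner product, so that the transpose of A is adjoint A and multipliers live in 'h. *)

definition inner_solution ::
  "('e::euclidean_space \<Rightarrow> real) \<Rightarrow> 'e set \<Rightarrow> ('e \<Rightarrow> 'h::euclidean_space) \<Rightarrow> 'h \<Rightarrow> 'e \<Rightarrow> bool"
where
  "inner_solution f Q A l x \<longleftrightarrow>
     is_arg_max (\<lambda>y. - f y - adjoint A l \<bullet> y) (\<lambda>y. y \<in> Q) x"

(* The supremum is a maximum as soon as the inner problem has a solution. *)
definition dual_obj ::
  "('e::euclidean_space \<Rightarrow> real) \<Rightarrow> 'e set \<Rightarrow> ('e \<Rightarrow> 'h::euclidean_space) \<Rightarrow> 'h \<Rightarrow> 'h \<Rightarrow> real"
where
  "dual_obj f Q A b l = l \<bullet> b + (SUP x\<in>Q. - f x - adjoint A l \<bullet> x)"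

(* The subgradient b - A (x l) depends on the choice of the inner solution x l. The bound is
   required for one choice only. The quantification over l includes that the maximum defining the
   dual objective is attained for every l. For l = m the inequality is trivial, so the
   convention 0 powr 0 = 0 does no harm when \<nu> = 0. *)
definition holder_subgradient ::
  "('e::euclidean_space \<Rightarrow> real) \<Rightarrow> 'e set \<Rightarrow> ('e \<Rightarrow> 'h::euclidean_space) \<Rightarrow> 'h \<Rightarrow> real \<Rightarrow> real \<Rightarrow> bool"
where
  "holder_subgradient f Q A b \<nu> M \<longleftrightarrow>
     (\<exists>x. (\<forall>l. inner_solution f Q A l (x l)) \<and>
          (\<forall>l m. norm ((b - A (x l)) - (b - A (x m))) \<le> M * norm (l - m) powr \<nu>))"

(* First N iterations of the method. The dual iterates are l, \<zeta>, \<eta>, the primal ones xhat;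
   Acc k stands for the accumulated weight A_k, and x k for the inner solution x(l k) that is
   chosen in iteration k. The choice is made per iteration and need not
   coincide with the one in holder_subgradient. The equation for a (Suc k) is only meaningful
   where its denominator Acc k + t does not vanish. *)
definition pdugdsdr ::
  "('e::euclidean_space \<Rightarrow> real) \<Rightarrow> 'e set \<Rightarrow> ('e \<Rightarrow> 'h::euclidean_space) \<Rightarrow> 'h \<Rightarrow> real \<Rightarrow> nat \<Rightarrow>
   (nat \<Rightarrow> real) \<Rightarrow> (nat \<Rightarrow> real) \<Rightarrow> (nat \<Rightarrow> real) \<Rightarrow> (nat \<Rightarrow> real) \<Rightarrow>
   (nat \<Rightarrow> 'h) \<Rightarrow> (nat \<Rightarrow> 'h) \<Rightarrow> (nat \<Rightarrow> 'h) \<Rightarrow> (nat \<Rightarrow> 'e) \<Rightarrow> (nat \<Rightarrow> 'e) \<Rightarrow> bool"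
where
  "pdugdsdr f Q A b \<epsilon> N \<beta> h a Acc l \<zeta> \<eta> x xhat \<longleftrightarrow>
     Acc 0 = 0 \<and> \<eta> 0 = 0 \<and> \<zeta> 0 = 0 \<and> l 0 = 0 \<and>
     (\<forall>k<N.
        let \<phi> = dual_obj f Q A b;
            g = b - A (x k);
            root = (\<lambda>t. Acc k + t \<noteq> 0 \<and>
                     \<phi> (\<eta> (Suc k)) = \<phi> (l k) - t\<^sup>2 / (2 * (Acc k + t)) * (norm g)\<^sup>2
                                        + \<epsilon> * t / (2 * (Acc k + t)))
        in
          is_arg_min (\<lambda>t. \<phi> (\<zeta> k + t *\<^sub>R (\<eta> k - \<zeta> k))) (\<lambda>t. t \<in> {0..1}) (\<beta> k) \<and>
          l k = \<zeta> k + \<beta> k *\<^sub>R (\<eta> k - \<zeta> k) \<and>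
          inner_solution f Q A (l k) (x k) \<and> g \<bullet> (\<zeta> k - l k) \<ge> 0 \<and>
          is_arg_min (\<lambda>t. \<phi> (l k - t *\<^sub>R g)) (\<lambda>t. t \<ge> 0) (h (Suc k)) \<and>
          \<eta> (Suc k) = l k - h (Suc k) *\<^sub>R g \<and>
          root (a (Suc k)) \<and> (\<forall>t. root t \<longrightarrow> t \<le> a (Suc k)) \<and>
          Acc (Suc k) = Acc k + a (Suc k) \<and>
          \<zeta> (Suc k) = \<zeta> k - a (Suc k) *\<^sub>R g \<and>
          xhat (Suc k) = (1 / Acc (Suc k)) *\<^sub>R (\<Sum>i=0..k. a (Suc i) *\<^sub>R x i))"

(* The value at \<nu> = 1 is the limit for \<nu> tending to 1 from below. *)
definition holder_factor :: "real \<Rightarrow> real" where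
  "holder_factor \<nu> =
     (if \<nu> = 1 then 1 else ((1 + \<nu>) / (1 - \<nu>)) powr ((1 - \<nu>) / (1 + \<nu>)))"

end

(* The linear minorants (b - A (x i)) . m - f (x i) of the dual objective, weighted by the a (Suc i)
   and regularized by half the squared norm, form an estimate sequence whose minimum dominates
   Acc k * (dual value at eta k - eps / 2). Jensen's inequality bounds the weighted minorants by the
   one of the averaged point xhat k. Evaluating at the multiplier of norm 2 R pointing against the
   residual, and comparing with weak duality at the optimal multiplier, gives both error bounds.

   Hoelder continuity gives a descent inequality, which Young's inequality turns into an inexact
   quadratic one. Comparing it with the root equation bounds a (Suc k) from below by a power of
   Acc (Suc k), so that Acc k powr (1 / q) with q = (1 + 3 nu) / (1 + nu) grows at least linearly. *)
theory Submission
  imports Defs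
begin

section \<open>The dual objective and its affine minorants\<close>

lemma dual_obj_eq:
  assumes "linear A" and "inner_solution f Q A l x"
  shows "dual_obj f Q A b l = (b - A x) \<bullet> l - f x"
proof -
  have "(SUP x\<in>Q. - f x - adjoint A l \<bullet> x) = - f x - adjoint A l \<bullet> x"
    using assms(2) unfolding inner_solution_def is_arg_max_def
    by (intro cSup_eq_maximum) (auto simp: not_less)
  then show ?thesis
    using assms(1) by (simp add: dual_obj_def adjoint_works inner_commute algebra_simps)
qed

text \<open>Serves twice: with \<open>y\<close> an inner solution at another multiplier it becomes
  the subgradient inequality, with \<open>y\<close> the averaged primal point it is weak
  duality.\<close>

lemma dual_obj_ge:
  assumes "linear A" and "inner_solution f Q A l x" and "y \<in> Q"
  shows "(b - A y) \<bullet> l - f y \<le> dual_obj f Q A b l"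
proof -
  have "- f y - adjoint A l \<bullet> y \<le> - f x - adjoint A l \<bullet> x"
    using assms(2,3) unfolding inner_solution_def is_arg_max_def by (auto simp: not_less)
  then show ?thesis
    using assms by (simp add: dual_obj_eq adjoint_works inner_commute algebra_simps)
qed

section \<open>Convexity inequalities for real powers\<close>

text \<open>Weighted AM-GM. Zero arguments do no harm even with exponent 0, since
  \<open>0 powr 0 = 0\<close> makes the left side vanish.\<close>

lemma weighted_powr_mean:
  fixes x y s t :: real
  assumes "0 \<le> x" "0 \<le> y" "0 \<le> s" "0 \<le> t" "s + t = 1"
  shows "x powr s * y powr t \<le> s * x + t * y"
  using assms Youngs_inequality_0 [of s t x y] by (cases "x = 0 \<or> y = 0") auto

text \<open>Convexity of the power, obtained from AM-GM for \<open>y powr (1 + \<nu>)\<close> and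
  \<open>x powr (1 + \<nu>)\<close> with weights 1 / (1 + \<nu>) and \<nu> / (1 + \<nu>), so that no
  derivative at 0 is involved.\<close>

lemma powr_tangent_below:
  fixes x y \<nu> :: real
  assumes "0 \<le> x" "0 \<le> y" "0 \<le> \<nu>"
  shows "x powr (1 + \<nu>) + (1 + \<nu>) * (y - x) * x powr \<nu> \<le> y powr (1 + \<nu>)"
proof -
  have "(y powr (1 + \<nu>)) powr (1 / (1 + \<nu>)) * (x powr (1 + \<nu>)) powr (\<nu> / (1 + \<nu>))
      \<le> 1 / (1 + \<nu>) * y powr (1 + \<nu>) + \<nu> / (1 + \<nu>) * x powr (1 + \<nu>)"
    using assms by (intro weighted_powr_mean) (auto simp: field_simps)
  then have "y * x powr \<nu> \<le> (y powr (1 + \<nu>) + \<nu> * x powr (1 + \<nu>)) / (1 + \<nu>)"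
    using assms by (simp add: powr_powr add_divide_distrib)
  then have "(1 + \<nu>) * (y * x powr \<nu>) \<le> y powr (1 + \<nu>) + \<nu> * x powr (1 + \<nu>)"
    using assms by (simp add: field_simps)
  moreover have "x powr (1 + \<nu>) = x * x powr \<nu>"
    using assms by (cases "x = 0") (auto simp: powr_add)
  ultimately show ?thesis
    by (simp add: algebra_simps)
qed

text \<open>Concavity of the power with exponent \<open>s\<close>: its tangent at \<open>v\<close>
  lies above. Multiplying by \<open>v powr (1 - s)\<close> turns this into AM-GM for
  \<open>u\<close> and \<open>v\<close>.\<close>

lemma powr_tangent_above:
  fixes u v s :: real
  assumes "0 \<le> u" "0 < v" "0 \<le> s" "s \<le> 1"
  shows "s * (v - u) \<le> (v powr s - u powr s) * v powr (1 - s)"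
proof -
  have "u powr s * v powr (1 - s) \<le> s * u + (1 - s) * v"
    using assms by (intro weighted_powr_mean) auto
  moreover have "v powr s * v powr (1 - s) = v"
    using assms by (simp add: powr_add [symmetric])
  ultimately show ?thesis
    by (simp add: algebra_simps)
qed

section \<open>Descent under a Hoelder-continuous subgradient selection\<close>

lemma subgradient_deviation:
  fixes \<phi> :: "'h::euclidean_space \<Rightarrow> real"
  assumes sel: "\<And>l m. \<phi> l + G l \<bullet> (m - l) \<le> \<phi> m"
    and holder: "\<And>l m. norm (G l - G m) \<le> M * norm (l - m) powr \<nu>"
    and sub: "\<And>m. \<phi> l + g \<bullet> (m - l) \<le> \<phi> m"
    and "0 < t"
  shows "(g - G (l - t *\<^sub>R g)) \<bullet> g \<le> M * (t * norm g) powr \<nu> * norm g"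
proof (cases "g = 0")
  case False
  define m where "m = l - t *\<^sub>R g"
  \<comment> \<open>The subgradient g need not be the selected one at l, but by monotonicity the selected
      subgradients at l + s g dominate it in direction g; let s tend to 0.\<close>
  have bound: "(g - G m) \<bullet> g \<le> M * ((s + t) * norm g) powr \<nu> * norm g" if "0 < s" for s
  proof -
    have "s * (g \<bullet> g) \<le> s * (G (l + s *\<^sub>R g) \<bullet> g)"
      using sub [of "l + s *\<^sub>R g"] sel [of "l + s *\<^sub>R g" l] by simp
    then have "g \<bullet> g \<le> G (l + s *\<^sub>R g) \<bullet> g"
      using that by simp
    then have "(g - G m) \<bullet> g \<le> (G (l + s *\<^sub>R g) - G m) \<bullet> g"
      by (simp add: inner_diff_left)
    also have "\<dots> \<le> norm (G (l + s *\<^sub>R g) - G m) * norm g"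
      by (rule norm_cauchy_schwarz)
    also have "\<dots> \<le> M * norm (l + s *\<^sub>R g - m) powr \<nu> * norm g"
      by (intro mult_right_mono holder) simp
    also have "l + s *\<^sub>R g - m = (s + t) *\<^sub>R g"
      by (simp add: m_def algebra_simps)
    finally show ?thesis
      using that \<open>0 < t\<close> by simp
  qed
  \<comment> \<open>The limiting base \<open>t * norm g\<close> is positive, so the power is
    continuous there even for \<nu> = 0.\<close>
  have "((\<lambda>s. M * ((s + t) * norm g) powr \<nu> * norm g) \<longlongrightarrow>
      M * ((0 + t) * norm g) powr \<nu> * norm g) (at_right 0)"
    using False \<open>0 < t\<close> by (intro tendsto_intros) auto
  then have "(g - G m) \<bullet> g \<le> M * ((0 + t) * norm g) powr \<nu> * norm g"
    by (rule tendsto_lowerbound)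
       (use bound in \<open>auto simp: eventually_at_filter intro!: always_eventually\<close>)
  then show ?thesis
    by (simp add: m_def)
qed simp

text \<open>Integration along the ray is replaced by a subdivision into \<open>n\<close> equal
  steps, because \<phi> need not be differentiable. The accumulated error is of order 1 / n and
  vanishes in the limit.\<close>

lemma holder_descent:
  fixes \<phi> :: "'h::euclidean_space \<Rightarrow> real"
  assumes sel: "\<And>l m. \<phi> l + G l \<bullet> (m - l) \<le> \<phi> m"
    and holder: "\<And>l m. norm (G l - G m) \<le> M * norm (l - m) powr \<nu>"
    and sub: "\<And>m. \<phi> l + g \<bullet> (m - l) \<le> \<phi> m"
    and "0 \<le> M" "0 \<le> \<nu>" "0 < h"
  shows "\<phi> (l - h *\<^sub>R g) \<le> \<phi> l - h * (norm g)\<^sup>2 + M / (1 + \<nu>) * (h * norm g) powr (1 + \<nu>)"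
proof -
  define r where "r = norm g"
  \<comment> \<open>The claim is exactly \<open>u h \<le> u 0\<close>.\<close>
  define u where "u t = \<phi> (l - t *\<^sub>R g) + t * r\<^sup>2 - M / (1 + \<nu>) * (t * r) powr (1 + \<nu>)" for t
  have r: "0 \<le> r" "g \<bullet> g = r\<^sup>2"
    by (auto simp: r_def power2_norm_eq_inner)
  \<comment> \<open>The change of \<phi> is bounded by the selected subgradient at the far end
    \<open>t\<close>, the power term by its tangent at the near end \<open>s\<close>. The mismatch
    is a difference of powers, which telescopes.\<close>
  have step: "u t - u s \<le> (t - s) * (M * r * ((t * r) powr \<nu> - (s * r) powr \<nu>))"
    if "0 \<le> s" "s < t" for s t
  proof -
    have "\<phi> (l - t *\<^sub>R g) - \<phi> (l - s *\<^sub>R g) \<le> - (t - s) * (G (l - t *\<^sub>R g) \<bullet> g)"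
      using sel [of "l - t *\<^sub>R g" "l - s *\<^sub>R g"]
      by (simp add: algebra_simps inner_diff_right)
    moreover have "(t - s) * (r\<^sup>2 - G (l - t *\<^sub>R g) \<bullet> g) \<le> (t - s) * (M * (t * r) powr \<nu> * r)"
      using subgradient_deviation [OF sel holder sub, of t] that r
      by (intro mult_left_mono) (auto simp: inner_diff_left r_def)
    moreover have "M / (1 + \<nu>) * ((s * r) powr (1 + \<nu>) + (1 + \<nu>) * (t * r - s * r) * (s * r) powr \<nu>)
        \<le> M / (1 + \<nu>) * (t * r) powr (1 + \<nu>)"
      using that r assms by (intro mult_left_mono powr_tangent_below) auto
    moreover have "M / (1 + \<nu>) * ((s * r) powr (1 + \<nu>) + (1 + \<nu>) * (t * r - s * r) * (s * r) powr \<nu>)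
        = M / (1 + \<nu>) * (s * r) powr (1 + \<nu>) + (t - s) * (M * r * (s * r) powr \<nu>)"
      using assms by (simp add: field_simps)
    ultimately show ?thesis
      unfolding u_def by (simp add: algebra_simps)
  qed
  have "u h - u 0 \<le> (h * (M * r * (h * r) powr \<nu>)) / real n" if "0 < n" for n :: nat
  proof -
    \<comment> \<open>The telescoping starts from \<open>0 powr \<nu> = 0\<close>, which holds for
      \<nu> = 0 as well.\<close>
    have "u (real j * h / n) - u 0 \<le> h / n * (M * r * (real j * h / n * r) powr \<nu>)" for j
    proof (induction j)
      case (Suc j)
      have "u (real (Suc j) * h / n) - u (real j * h / n) \<le>
          h / n * (M * r * ((real (Suc j) * h / n * r) powr \<nu> - (real j * h / n * r) powr \<nu>))"
        using step [of "real j * h / n" "real (Suc j) * h / n"] that \<open>0 < h\<close>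
        by (simp add: field_simps)
      with Suc show ?case
        by (simp add: algebra_simps)
    qed simp
    from this [of n] show ?thesis
      using that by simp
  qed
  then have "\<forall>\<^sub>F n in sequentially. u h - u 0 \<le> (h * (M * r * (h * r) powr \<nu>)) / real n"
    by (auto simp: eventually_sequentially intro!: exI [of _ 1])
  then have "u h - u 0 \<le> 0"
    by (intro tendsto_lowerbound [OF lim_const_over_n]) auto
  then show ?thesis
    by (simp add: u_def r_def)
qed

text \<open>For \<nu> < 1 this is AM-GM with weight \<theta> = (1 + \<nu>) / 2 on
  \<open>L / (1 + \<nu>) * t\<^sup>2\<close> and weight 1 - \<theta> on
  \<open>\<delta> / (1 - \<nu>)\<close>. \<open>L\<close> is the value for which the constants on
  the left combine to M / (1 + \<nu>); \<open>holder_factor\<close> collects the ratio of the two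
  denominators.\<close>

lemma holder_factor_young:
  fixes t \<delta> :: real
  assumes "0 \<le> \<nu>" "\<nu> \<le> 1" "0 < M" "0 < \<delta>" "0 \<le> t"
  defines "p \<equiv> (1 - \<nu>) / (1 + \<nu>)"
  defines "L \<equiv> M powr (2 / (1 + \<nu>)) / (holder_factor \<nu> * \<delta> powr p)"
  shows "M / (1 + \<nu>) * t powr (1 + \<nu>) \<le> L / 2 * t\<^sup>2 + \<delta> / 2"
proof (cases "\<nu> = 1")
  case True
  then show ?thesis
    using assms by (cases "t = 0") (auto simp: L_def p_def holder_factor_def powr_numeral)
next
  case False
  then have nu: "0 < 1 - \<nu>" "0 < 1 + \<nu>"
    using assms by auto
  define \<theta> where "\<theta> = (1 + \<nu>) / 2"
  have th: "0 \<le> \<theta>" "0 \<le> 1 - \<theta>" "p * \<theta> = 1 - \<theta>" "2 / (1 + \<nu>) * \<theta> = 1" "2 * \<theta> = 1 + \<nu>"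
    using nu by (auto simp: \<theta>_def p_def field_simps)
  have L: "0 < L"
    using assms nu False by (simp add: L_def holder_factor_def)
  have *: "(L / (1 + \<nu>)) powr \<theta> * (\<delta> / (1 - \<nu>)) powr (1 - \<theta>) = M / (1 + \<nu>)"
  proof -
    define B where "B = (1 + \<nu>) / (1 - \<nu>)"
    have "0 < B" "holder_factor \<nu> = B powr p"
      using nu False by (simp_all add: B_def p_def holder_factor_def)
    then have "L powr \<theta> = M powr (2 / (1 + \<nu>) * \<theta>) / (B powr (p * \<theta>) * \<delta> powr (p * \<theta>))"
      using assms(3,4) by (simp add: L_def powr_divide powr_mult powr_powr)
    then have "L powr \<theta> = M / (((1 + \<nu>) / (1 - \<nu>)) powr (1 - \<theta>) * \<delta> powr (1 - \<theta>))"
      unfolding th(3,4) B_def using assms(3) by simp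
    then have "(L / (1 + \<nu>)) powr \<theta> * (\<delta> / (1 - \<nu>)) powr (1 - \<theta>)
        = M / ((1 + \<nu>) powr \<theta> * (1 + \<nu>) powr (1 - \<theta>))"
      using nu L \<open>0 < \<delta>\<close> by (simp add: powr_divide)
    then show ?thesis
      using nu by (simp add: powr_add [symmetric])
  qed
  have t2: "(t\<^sup>2) powr \<theta> = t powr (1 + \<nu>)"
    using assms th(5) by (cases "t = 0") (auto simp: powr_powr simp flip: powr_numeral)
  have "(L / (1 + \<nu>) * t\<^sup>2) powr \<theta> * (\<delta> / (1 - \<nu>)) powr (1 - \<theta>)
      \<le> \<theta> * (L / (1 + \<nu>) * t\<^sup>2) + (1 - \<theta>) * (\<delta> / (1 - \<nu>))"
    using L nu \<open>0 < \<delta>\<close> th by (intro weighted_powr_mean) auto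
  also have "\<dots> = L / 2 * t\<^sup>2 + \<delta> / 2"
  proof -
    have "\<theta> / (1 + \<nu>) = 1 / 2" "(1 - \<theta>) / (1 - \<nu>) = 1 / 2"
      using nu by (simp_all add: \<theta>_def field_simps)
    then show ?thesis
      by (metis mult.assoc mult.commute mult_1 times_divide_eq_left times_divide_eq_right)
  qed
  also have "(L / (1 + \<nu>) * t\<^sup>2) powr \<theta> = (L / (1 + \<nu>)) powr \<theta> * t powr (1 + \<nu>)"
    using L nu by (subst powr_mult) (auto simp: t2)
  finally show ?thesis
    using * by (simp add: mult_ac)
qed

section \<open>Scalar facts on the step equation and on growth\<close>

text \<open>For \<open>r \<noteq> 0\<close> the cleared equation is a quadratic with an explicit
  positive root, which the largest root dominates. For \<open>r = 0\<close> the equation reduces to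
  \<epsilon> t = 0.\<close>

lemma largest_root_pos:
  fixes s t u v r \<epsilon> :: real
  defines "isroot \<equiv> \<lambda>t. s + t \<noteq> 0 \<and>
    u = v - t\<^sup>2 / (2 * (s + t)) * r\<^sup>2 + \<epsilon> * t / (2 * (s + t))"
  assumes "isroot t" and largest: "\<And>t'. isroot t' \<Longrightarrow> t' \<le> t"
    and "0 \<le> s" "0 < \<epsilon>" "u \<le> v" "r = 0 \<Longrightarrow> u = v"
  shows "0 \<le> t" and "0 < s + t" and "r \<noteq> 0 \<Longrightarrow> 0 < t"
proof -
  have pos: "0 < t" if "r \<noteq> 0"
  proof -
    \<comment> \<open>Quadratic formula for
      \<open>r\<^sup>2 * z\<^sup>2 - B * z - 2 * (v - u) * s = 0\<close>, the equation with its
      denominator cleared.\<close>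
    define B where "B = \<epsilon> + 2 * (v - u)"
    define S where "S = sqrt (B\<^sup>2 + 8 * r\<^sup>2 * (v - u) * s)"
    define z where "z = (B + S) / (2 * r\<^sup>2)"
    have B: "0 < B" "0 \<le> S" "S\<^sup>2 = B\<^sup>2 + 8 * r\<^sup>2 * (v - u) * s"
      using assms by (auto simp: B_def S_def)
    have r: "0 < r\<^sup>2"
      using that by simp
    then have z: "0 < z"
      using B by (simp add: z_def)
    have "2 * r\<^sup>2 * z - B = S"
      using r by (simp add: z_def)
    then have "(2 * r\<^sup>2 * z - B)\<^sup>2 = B\<^sup>2 + 8 * r\<^sup>2 * (v - u) * s"
      using B by simp
    then have "4 * r\<^sup>2 * (r\<^sup>2 * z\<^sup>2 - B * z - 2 * (v - u) * s) = 0"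
      by (simp add: power2_eq_square algebra_simps)
    then have "r\<^sup>2 * z\<^sup>2 - B * z - 2 * (v - u) * s = 0"
      using r by simp
    then have "z\<^sup>2 * r\<^sup>2 - \<epsilon> * z = (v - u) * (2 * (s + z))"
      by (simp add: B_def algebra_simps)
    then have "(z\<^sup>2 * r\<^sup>2 - \<epsilon> * z) / (2 * (s + z)) = v - u"
      using z \<open>0 \<le> s\<close> by simp
    then have "isroot z"
      using z \<open>0 \<le> s\<close> unfolding isroot_def by (simp add: diff_divide_distrib)
    then show ?thesis
      using largest z by force
  qed
  have zero: "t = 0" if "r = 0"
    using \<open>isroot t\<close> assms that unfolding isroot_def by auto
  show "r \<noteq> 0 \<Longrightarrow> 0 < t" by (fact pos)
  show "0 \<le> t" using pos zero by force
  then show "0 < s + t" using \<open>isroot t\<close> \<open>0 \<le> s\<close> unfolding isroot_def by linarith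
qed

text \<open>The \<open>q\<close>-th root of the hypothesis bounds \<open>t\<close> from below, and
  concavity of the power 1 / q turns this into an increment that does not depend on
  \<open>s\<close>.\<close>

lemma powr_growth_step:
  fixes s t c q :: real
  assumes "0 \<le> s" "0 < t" "0 \<le> c" "1 \<le> q" "q \<le> 2"
    and "c * (s + t) powr (q - 1) \<le> t powr q"
  shows "s powr (1 / q) + c powr (1 / q) / 2 \<le> (s + t) powr (1 / q)"
proof -
  have "(c * (s + t) powr (q - 1)) powr (1 / q) \<le> (t powr q) powr (1 / q)"
    using assms by (intro powr_mono2) auto
  moreover have "(q - 1) * (1 / q) = 1 - 1 / q"
    using assms by (simp add: field_simps)
  ultimately have "c powr (1 / q) * (s + t) powr (1 - 1 / q) \<le> t"
    using assms by (simp add: powr_mult powr_powr)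
  \<comment> \<open>Here \<open>q \<le> 2\<close> is used to weaken 1 / q to 1 / 2, the source of
    the power of 2 in the final bound.\<close>
  then have "1 / 2 * (c powr (1 / q) * (s + t) powr (1 - 1 / q)) \<le> 1 / q * t"
    using assms by (intro mult_mono) (auto simp: field_simps)
  also have "1 / q * t = 1 / q * (s + t - s)"
    by simp
  also have "\<dots> \<le> ((s + t) powr (1 / q) - s powr (1 / q)) * (s + t) powr (1 - 1 / q)"
    using assms by (intro powr_tangent_above) auto
  finally have "c powr (1 / q) / 2 * (s + t) powr (1 - 1 / q)
      \<le> ((s + t) powr (1 / q) - s powr (1 / q)) * (s + t) powr (1 - 1 / q)"
    by simp
  then show ?thesis
    using assms by simp
qed


section \<open>One iteration and the estimate sequence\<close>

text \<open>The exact line searches enter only by comparison: the first with its endpoint 1, which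
  is \<open>\<eta> k\<close>, the second with an arbitrary step length.\<close>

lemma pdugdsdr_step:
  assumes "linear A" "0 < \<epsilon>" "0 \<le> Acc k" "k < N"
    and run: "pdugdsdr f Q A b \<epsilon> N \<beta> h a Acc l \<zeta> \<eta> x xhat"
  defines "\<phi> \<equiv> dual_obj f Q A b" and "g \<equiv> b - A (x k)"
  shows "0 \<le> a (Suc k)" and "0 < Acc (Suc k)" and "g \<noteq> 0 \<Longrightarrow> 0 < a (Suc k)"
    and "\<phi> (l k) \<le> \<phi> (\<eta> k)"
    and "\<And>t. 0 \<le> t \<Longrightarrow> \<phi> (\<eta> (Suc k)) \<le> \<phi> (l k - t *\<^sub>R g)"
    and "Acc (Suc k) * \<phi> (\<eta> (Suc k)) =
      Acc (Suc k) * \<phi> (l k) - (a (Suc k))\<^sup>2 / 2 * (norm g)\<^sup>2 + \<epsilon> * a (Suc k) / 2"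
    and "Acc (Suc k) = Acc k + a (Suc k)"
    and "\<zeta> (Suc k) = \<zeta> k - a (Suc k) *\<^sub>R g"
    and "0 \<le> g \<bullet> (\<zeta> k - l k)"
    and "inner_solution f Q A (l k) (x k)"
    and "xhat (Suc k) = (1 / Acc (Suc k)) *\<^sub>R (\<Sum>i=0..k. a (Suc i) *\<^sub>R x i)"
proof -
  let ?root = "\<lambda>t. Acc k + t \<noteq> 0 \<and> \<phi> (\<eta> (Suc k)) =
    \<phi> (l k) - t\<^sup>2 / (2 * (Acc k + t)) * (norm g)\<^sup>2 + \<epsilon> * t / (2 * (Acc k + t))"
  have *: "is_arg_min (\<lambda>t. \<phi> (\<zeta> k + t *\<^sub>R (\<eta> k - \<zeta> k))) (\<lambda>t. t \<in> {0..1}) (\<beta> k)"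
      "l k = \<zeta> k + \<beta> k *\<^sub>R (\<eta> k - \<zeta> k)"
      "is_arg_min (\<lambda>t. \<phi> (l k - t *\<^sub>R g)) (\<lambda>t. t \<ge> 0) (h (Suc k))"
      "\<eta> (Suc k) = l k - h (Suc k) *\<^sub>R g"
      "?root (a (Suc k))" "\<And>t. ?root t \<Longrightarrow> t \<le> a (Suc k)"
    and **: "Acc (Suc k) = Acc k + a (Suc k)"
      "\<zeta> (Suc k) = \<zeta> k - a (Suc k) *\<^sub>R g"
      "0 \<le> g \<bullet> (\<zeta> k - l k)"
      "inner_solution f Q A (l k) (x k)"
      "xhat (Suc k) = (1 / Acc (Suc k)) *\<^sub>R (\<Sum>i=0..k. a (Suc i) *\<^sub>R x i)"
    using run \<open>k < N\<close> unfolding pdugdsdr_def Let_def \<phi>_def g_def by blast+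
  show "Acc (Suc k) = Acc k + a (Suc k)"
    "\<zeta> (Suc k) = \<zeta> k - a (Suc k) *\<^sub>R g"
    "0 \<le> g \<bullet> (\<zeta> k - l k)"
    "inner_solution f Q A (l k) (x k)"
    "xhat (Suc k) = (1 / Acc (Suc k)) *\<^sub>R (\<Sum>i=0..k. a (Suc i) *\<^sub>R x i)"
    by (fact **)+
  show "\<phi> (l k) \<le> \<phi> (\<eta> k)"
    using *(1) unfolding *(2) is_arg_min_def by (auto simp: not_less dest: spec [of _ 1])
  show line: "\<phi> (\<eta> (Suc k)) \<le> \<phi> (l k - t *\<^sub>R g)" if "0 \<le> t" for t
    using *(3) that unfolding *(4) is_arg_min_def by (auto simp: not_less)
  \<comment> \<open>Step length 0 shows that the search does not increase \<phi>; for
    \<open>g = 0\<close> the search cannot move at all.\<close>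
  have le: "\<phi> (\<eta> (Suc k)) \<le> \<phi> (l k)" and eq: "norm g = 0 \<Longrightarrow> \<phi> (\<eta> (Suc k)) = \<phi> (l k)"
    using line [of 0] *(4) by auto
  note root_pos = largest_root_pos [OF *(5) *(6) assms(3,2) le eq]
  show "0 \<le> a (Suc k)" and "g \<noteq> 0 \<Longrightarrow> 0 < a (Suc k)"
    using root_pos(1,3) by auto
  show pos: "0 < Acc (Suc k)"
    using root_pos(2) **(1) by simp
  show "Acc (Suc k) * \<phi> (\<eta> (Suc k)) =
      Acc (Suc k) * \<phi> (l k) - (a (Suc k))\<^sup>2 / 2 * (norm g)\<^sup>2 + \<epsilon> * a (Suc k) / 2"
    using *(5) pos unfolding **(1) [symmetric] by (simp add: field_simps)
qed

lemma Acc_nonneg: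
  assumes "linear A" "0 < \<epsilon>"
    and run: "pdugdsdr f Q A b \<epsilon> N \<beta> h a Acc l \<zeta> \<eta> x xhat"
  shows "k \<le> N \<Longrightarrow> 0 \<le> Acc k"
proof (induction k)
  case 0
  then show ?case using run by (simp add: pdugdsdr_def)
next
  case (Suc k)
  then show ?case
    using pdugdsdr_step(2) [OF assms(1,2) _ _ run, of k] by simp
qed

text \<open>The right-hand side is a quadratic in \<open>m\<close> with Hessian the identity and minimizer \<open>\<zeta> k\<close>;
  keeping the distance term instead of only the minimal value makes the induction go through.\<close>

lemma estimate_sequence:
  assumes "linear A" "0 < \<epsilon>"
    and run: "pdugdsdr f Q A b \<epsilon> N \<beta> h a Acc l \<zeta> \<eta> x xhat"
  shows "k \<le> N \<Longrightarrow>
    Acc k * dual_obj f Q A b (\<eta> k) - \<epsilon> * Acc k / 2 + (norm (m - \<zeta> k))\<^sup>2 / 2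
      \<le> (\<Sum>i<k. a (Suc i) * ((b - A (x i)) \<bullet> m - f (x i))) + (norm m)\<^sup>2 / 2"
proof (induction k)
  case 0
  then show ?case using run by (simp add: pdugdsdr_def)
next
  case (Suc k)
  define \<phi> where "\<phi> = dual_obj f Q A b"
  define g where "g = b - A (x k)"
  define t where "t = a (Suc k)"
  from Suc.prems have k: "k < N" "k \<le> N" by auto
  note nonneg = Acc_nonneg [OF assms k(2)]
  note step = pdugdsdr_step [OF assms(1,2) nonneg k(1) run, folded \<phi>_def g_def t_def]
  have "g \<bullet> m - f (x k) = \<phi> (l k) + g \<bullet> (m - l k)"
    using dual_obj_eq [OF assms(1) step(10), of b]
    by (simp add: \<phi>_def g_def inner_diff_right)
  then have "t * (g \<bullet> m - f (x k)) = t * \<phi> (l k) + t * (g \<bullet> (m - \<zeta> k)) + t * (g \<bullet> (\<zeta> k - l k))"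
    by (simp add: inner_diff_right algebra_simps)
  \<comment> \<open>The sign condition on the chosen subgradient lets the minorant be recentred from
    \<open>l k\<close> to \<open>\<zeta> k\<close>.\<close>
  moreover have "0 \<le> t * (g \<bullet> (\<zeta> k - l k))"
    using step(1,9) by simp
  moreover have "Acc k * \<phi> (l k) \<le> Acc k * \<phi> (\<eta> k)"
    using step(4) nonneg by (intro mult_left_mono)
  moreover have "(norm (m - \<zeta> (Suc k)))\<^sup>2 = (norm (m - \<zeta> k))\<^sup>2 + 2 * (t * (g \<bullet> (m - \<zeta> k))) + t\<^sup>2 * (norm g)\<^sup>2"
    unfolding step(8) power2_norm_eq_inner
    by (simp add: inner_diff_left inner_diff_right inner_commute power2_eq_square algebra_simps)
  moreover have "Acc (Suc k) * \<phi> (l k) = Acc k * \<phi> (l k) + t * \<phi> (l k)"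
    "\<epsilon> * Acc (Suc k) = \<epsilon> * Acc k + \<epsilon> * t"
    unfolding step(7) by (simp_all add: algebra_simps)
  \<comment> \<open>The root equation compensates the quadratic term from shifting the centre to
    \<open>\<zeta> (Suc k)\<close>, at the price of \<epsilon> t / 2.\<close>
  moreover have "Acc (Suc k) * \<phi> (\<eta> (Suc k)) = Acc (Suc k) * \<phi> (l k) - t\<^sup>2 * (norm g)\<^sup>2 / 2 + \<epsilon> * t / 2"
    using step(6) by simp
  moreover have "(\<Sum>i<Suc k. a (Suc i) * ((b - A (x i)) \<bullet> m - f (x i))) =
      (\<Sum>i<k. a (Suc i) * ((b - A (x i)) \<bullet> m - f (x i))) + t * (g \<bullet> m - f (x k))"
    by (simp add: g_def t_def)
  moreover note Suc.IH [OF k(2), folded \<phi>_def]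
  ultimately show ?case
    unfolding \<phi>_def [symmetric] by linarith
qed

section \<open>Primal averaging and the error bounds\<close>

text \<open>Since \<open>Acc 0 = 0\<close>, the weights sum to \<open>Acc k\<close> and normalize to
  a convex combination. The affine part passes through the average exactly, and Jensen's inequality
  handles \<open>f\<close>.\<close>

lemma primal_average:
  assumes "linear A" "0 < \<epsilon>" "convex Q" "convex_on Q f" "k \<le> N" "1 \<le> k"
    and run: "pdugdsdr f Q A b \<epsilon> N \<beta> h a Acc l \<zeta> \<eta> x xhat"
  shows "xhat k \<in> Q" and "0 < Acc k"
    and "(\<Sum>i<k. a (Suc i) * ((b - A (x i)) \<bullet> m - f (x i))) \<le> Acc k * ((b - A (xhat k)) \<bullet> m - f (xhat k))"
proof -
  note step = pdugdsdr_step [OF assms(1,2) Acc_nonneg [OF assms(1,2) run] _ run]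
  obtain n where n: "k = Suc n"
    using assms by (cases k) auto
  show pos: "0 < Acc k"
    using step(2) [of n] n assms by simp
  have sum: "(\<Sum>i<j. a (Suc i)) = Acc j" if "j \<le> N" for j
    using that
  proof (induction j)
    case 0
    then show ?case using run by (simp add: pdugdsdr_def)
  next
    case (Suc j)
    then show ?case using step(7) [of j] by simp
  qed
  define w where "w i = a (Suc i) / Acc k" for i
  have w: "sum w {..<k} = 1" "\<And>i. i < k \<Longrightarrow> 0 \<le> w i" "\<And>i. i < k \<Longrightarrow> x i \<in> Q"
    using sum [OF \<open>k \<le> N\<close>] pos step(1,10) assms
    by (auto simp: w_def inner_solution_def is_arg_max_def simp flip: sum_divide_distrib)
  have "xhat k = (1 / Acc k) *\<^sub>R (\<Sum>i=0..n. a (Suc i) *\<^sub>R x i)"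
    using step(11) [of n] n assms by simp
  also have "{0..n} = {..<k}"
    using n by auto
  finally have xhat: "xhat k = (\<Sum>i<k. w i *\<^sub>R x i)"
    by (simp add: w_def scaleR_right.sum)
  show "xhat k \<in> Q"
    unfolding xhat using w \<open>convex Q\<close> by (intro convex_sum) auto
  have "f (xhat k) \<le> (\<Sum>i<k. w i * f (x i))"
    unfolding xhat using w assms n by (intro convex_on_sum [where C = Q]) auto
  moreover have "A (xhat k) \<bullet> m = (\<Sum>i<k. w i * (A (x i) \<bullet> m))"
    unfolding xhat using \<open>linear A\<close>
    by (simp add: linear_sum linear_scale inner_sum_left)
  moreover have "(\<Sum>i<k. w i * ((b - A (x i)) \<bullet> m - f (x i)))
      = (\<Sum>i<k. w i) * (b \<bullet> m) - (\<Sum>i<k. w i * (A (x i) \<bullet> m)) - (\<Sum>i<k. w i * f (x i))"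
    by (simp add: inner_diff_left algebra_simps sum_subtractf sum.distrib sum_distrib_left)
  ultimately have "(\<Sum>i<k. w i * ((b - A (x i)) \<bullet> m - f (x i))) \<le> (b - A (xhat k)) \<bullet> m - f (xhat k)"
    using w(1) by (simp add: inner_diff_left)
  then have "Acc k * (\<Sum>i<k. w i * ((b - A (x i)) \<bullet> m - f (x i))) \<le> Acc k * ((b - A (xhat k)) \<bullet> m - f (xhat k))"
    using pos by (intro mult_left_mono) auto
  then show "(\<Sum>i<k. a (Suc i) * ((b - A (x i)) \<bullet> m - f (x i))) \<le> Acc k * ((b - A (xhat k)) \<bullet> m - f (xhat k))"
    using pos by (simp add: w_def sum_distrib_left)
qed

lemma primal_dual_bounds:
  assumes "linear A" "0 < \<epsilon>" "convex Q" "convex_on Q f" "k \<le> N" "1 \<le> k"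
    and run: "pdugdsdr f Q A b \<epsilon> N \<beta> h a Acc l \<zeta> \<eta> x xhat"
    and "inner_solution f Q A lopt y" "\<And>m. dual_obj f Q A b lopt \<le> dual_obj f Q A b m"
    and "norm lopt \<le> R" "0 < R"
  shows "norm (A (xhat k) - b) \<le> 2 * R / Acc k + \<epsilon> / (2 * R)"
    and "\<bar>dual_obj f Q A b (\<eta> k) + f (xhat k)\<bar> \<le> 2 * R\<^sup>2 / Acc k + \<epsilon> / 2"
proof -
  define v where "v = b - A (xhat k)"
  define D where "D = dual_obj f Q A b (\<eta> k) + f (xhat k)"
  note avg = primal_average [OF assms(1-6) run]
  have upper: "D \<le> v \<bullet> m + (norm m)\<^sup>2 / (2 * Acc k) + \<epsilon> / 2" for m
  proof -
    have "Acc k * dual_obj f Q A b (\<eta> k) - \<epsilon> * Acc k / 2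
        \<le> Acc k * (v \<bullet> m - f (xhat k)) + (norm m)\<^sup>2 / 2"
      using estimate_sequence [OF assms(1,2) run assms(5), of m] avg(3) [of m]
        zero_le_power2 [of "norm (m - \<zeta> k)"]
      unfolding v_def by linarith
    then have "Acc k * D \<le> Acc k * (v \<bullet> m + (norm m)\<^sup>2 / (2 * Acc k) + \<epsilon> / 2)"
      using avg(2) by (simp add: D_def algebra_simps)
    then show ?thesis
      using avg(2) by simp
  qed
  \<comment> \<open>Weak duality at \<open>lopt\<close>, followed by optimality of
    \<open>lopt\<close> against \<open>\<eta> k\<close>.\<close>
  have "v \<bullet> lopt \<le> D"
    using dual_obj_ge [OF assms(1) assms(8) avg(1), of b] assms(9) [of "\<eta> k"]
    by (simp add: v_def D_def)
  moreover have "- (norm v * R) \<le> v \<bullet> lopt"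
    using norm_cauchy_schwarz [of "- v" lopt] mult_left_mono [OF \<open>norm lopt \<le> R\<close>, of "norm v"]
    by simp
  ultimately have lower: "- (norm v * R) \<le> D"
    by linarith
  \<comment> \<open>The multiplier \<open>(- 2 * R) *\<^sub>R sgn v\<close> contributes -2R times
    the norm of \<open>v\<close>. The lower bound on \<open>D\<close> takes up half of that, and the
    other half bounds the residual; \<open>sgn\<close> also covers \<open>v = 0\<close>.\<close>
  have "(norm (sgn v))\<^sup>2 \<le> 1"
    by (simp add: norm_sgn)
  then have "(norm ((- 2 * R) *\<^sub>R sgn v))\<^sup>2 / (2 * Acc k) \<le> (4 * R\<^sup>2 * 1) / (2 * Acc k)"
    using avg(2) unfolding norm_scaleR power_mult_distrib
    by (intro divide_right_mono mult_mono) (auto simp: power2_eq_square)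
  moreover have "v \<bullet> ((- 2 * R) *\<^sub>R sgn v) = - (2 * R * norm v)"
    by (cases "v = 0")
       (simp_all add: sgn_div_norm power2_norm_eq_inner [symmetric] power2_eq_square)
  ultimately have "D \<le> - (2 * R * norm v) + 2 * R\<^sup>2 / Acc k + \<epsilon> / 2"
    using upper [of "(- 2 * R) *\<^sub>R sgn v"] \<open>0 < R\<close> by auto
  with lower have v: "R * norm v \<le> 2 * R\<^sup>2 / Acc k + \<epsilon> / 2"
    by (simp add: algebra_simps)
  also have "\<dots> = R * (2 * R / Acc k + \<epsilon> / (2 * R))"
    using \<open>0 < R\<close> by (simp add: field_simps power2_eq_square)
  finally show "norm (A (xhat k) - b) \<le> 2 * R / Acc k + \<epsilon> / (2 * R)"
    using \<open>0 < R\<close> by (simp add: v_def norm_minus_commute)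
  \<comment> \<open>The upper bound on \<open>D\<close> comes from the multiplier 0, the lower one
    from the residual bound just obtained.\<close>
  have "0 \<le> 2 * R\<^sup>2 / Acc k"
    using avg(2) by simp
  then have "D \<le> 2 * R\<^sup>2 / Acc k + \<epsilon> / 2"
    using upper [of 0] by simp
  moreover have "- D \<le> 2 * R\<^sup>2 / Acc k + \<epsilon> / 2"
    using lower v by (simp add: mult.commute)
  ultimately show "\<bar>dual_obj f Q A b (\<eta> k) + f (xhat k)\<bar> \<le> 2 * R\<^sup>2 / Acc k + \<epsilon> / 2"
    by (simp flip: D_def)
qed

section \<open>Growth of the accumulated weights\<close>

lemma weight_growth:
  assumes "linear A" "0 < \<epsilon>" "k < N" "0 \<le> \<nu>" "\<nu> \<le> 1" "0 < M"
    and "holder_subgradient f Q A b \<nu> M"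
    and run: "pdugdsdr f Q A b \<epsilon> N \<beta> h a Acc l \<zeta> \<eta> x xhat"
    and "b - A (x k) \<noteq> 0"
  defines "p \<equiv> (1 - \<nu>) / (1 + \<nu>)"
  defines "c \<equiv> holder_factor \<nu> * \<epsilon> powr p / M powr (2 / (1 + \<nu>))"
  shows "Acc k powr (1 / (2 - p)) + c powr (1 / (2 - p)) / 2 \<le> Acc (Suc k) powr (1 / (2 - p))"
proof -
  define \<phi> where "\<phi> = dual_obj f Q A b"
  define g where "g = b - A (x k)"
  define t where "t = a (Suc k)"
  \<comment> \<open>With this inexactness the error terms of the descent step and of the root equation cancel.\<close>
  define \<delta> where "\<delta> = \<epsilon> * t / Acc (Suc k)"
  define L where "L = M powr (2 / (1 + \<nu>)) / (holder_factor \<nu> * \<delta> powr p)"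
  have nonneg: "0 \<le> Acc k"
    using Acc_nonneg [OF assms(1,2) run] \<open>k < N\<close> by simp
  note step = pdugdsdr_step [OF assms(1,2) nonneg assms(3) run, folded \<phi>_def g_def t_def]
  have g: "0 < norm g"
    using assms(9) by (simp add: g_def)
  have t: "0 < t"
    using step(3) g by simp
  have \<delta>: "0 < \<delta>"
    using t step(2) \<open>0 < \<epsilon>\<close> by (simp add: \<delta>_def)
  have factor: "0 < holder_factor \<nu>"
    using assms(4,5) by (simp add: holder_factor_def)
  have L: "0 < L"
    using factor \<delta> \<open>0 < M\<close> by (simp add: L_def)
  obtain X where X: "\<And>l. inner_solution f Q A l (X l)"
    and holder: "\<And>l m. norm ((b - A (X l)) - (b - A (X m))) \<le> M * norm (l - m) powr \<nu>"
    using assms(7) unfolding holder_subgradient_def by blast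
  have sub: "\<phi> l + (b - A y) \<bullet> (m - l) \<le> \<phi> m" if "inner_solution f Q A l y" for l m y
  proof -
    have "y \<in> Q"
      using that by (simp add: inner_solution_def is_arg_max_def)
    then show ?thesis
      using dual_obj_eq [OF assms(1) that, of b] dual_obj_ge [OF assms(1) X, of y b m]
      by (simp add: \<phi>_def inner_diff_right)
  qed
  \<comment> \<open>Step length 1 / L minimizes the quadratic model with curvature \<open>L\<close>
    along the ray.\<close>
  have "\<phi> (\<eta> (Suc k)) \<le> \<phi> (l k - (1 / L) *\<^sub>R g)"
    using L by (intro step(5)) auto
  also have "\<dots> \<le> \<phi> (l k) - 1 / L * (norm g)\<^sup>2 + M / (1 + \<nu>) * (1 / L * norm g) powr (1 + \<nu>)"
    using L assms(4,6) holder sub [OF X] sub [OF step(10)]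
    by (intro holder_descent [where G = "\<lambda>l. b - A (X l)"]) (auto simp: g_def)
  also have "M / (1 + \<nu>) * (1 / L * norm g) powr (1 + \<nu>) \<le> L / 2 * (1 / L * norm g)\<^sup>2 + \<delta> / 2"
    unfolding L_def p_def using assms(4-6) \<delta> g L factor
    by (intro holder_factor_young) (auto simp: L_def)
  also have "L / 2 * (1 / L * norm g)\<^sup>2 = 1 / (2 * L) * (norm g)\<^sup>2"
    using L by (simp add: power2_eq_square)
  finally have "\<phi> (\<eta> (Suc k)) \<le> \<phi> (l k) - 1 / (2 * L) * (norm g)\<^sup>2 + \<delta> / 2"
    by simp
  then have "Acc (Suc k) * \<phi> (\<eta> (Suc k)) \<le> Acc (Suc k) * (\<phi> (l k) - 1 / (2 * L) * (norm g)\<^sup>2 + \<delta> / 2)"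
    using step(2) by (intro mult_left_mono) auto
  also have "\<dots> = Acc (Suc k) * \<phi> (l k) - Acc (Suc k) / L / 2 * (norm g)\<^sup>2 + \<epsilon> * t / 2"
    using step(2) by (simp add: \<delta>_def algebra_simps)
  finally have "Acc (Suc k) / L * (norm g)\<^sup>2 \<le> t\<^sup>2 * (norm g)\<^sup>2"
    using step(6) by simp
  then have "Acc (Suc k) / L \<le> t\<^sup>2"
    by (rule mult_right_le_imp_le) (use g in simp)
  \<comment> \<open>\<open>L\<close> itself depends on \<open>t\<close> through \<delta>; separating
    the powers of \<open>t\<close> leaves exponent 2 - p, the \<open>q\<close> of
    \<open>powr_growth_step\<close>.\<close>
  moreover have "Acc (Suc k) / L = c * Acc (Suc k) powr (1 - p) * t powr p"
    using \<open>0 < \<epsilon>\<close> t step(2) by (simp add: L_def c_def \<delta>_def powr_mult powr_divide powr_diff)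
  moreover have "t\<^sup>2 = t powr (2 - p) * t powr p"
    using t by (simp add: powr_add [symmetric] powr_numeral)
  ultimately have "c * (Acc k + t) powr ((2 - p) - 1) \<le> t powr (2 - p)"
    using t step(7) by simp
  moreover have "0 \<le> p" "p \<le> 1"
    using assms(4,5) by (auto simp: p_def)
  moreover have "0 \<le> c"
    using factor by (simp add: c_def)
  ultimately show ?thesis
    unfolding step(7) using nonneg t by (intro powr_growth_step) auto
qed

lemma weight_lower_bound:
  assumes "linear A" "0 < \<epsilon>" "k \<le> N" "1 \<le> k" "0 \<le> \<nu>" "\<nu> \<le> 1" "0 \<le> M"
    and "holder_subgradient f Q A b \<nu> M"
    and run: "pdugdsdr f Q A b \<epsilon> N \<beta> h a Acc l \<zeta> \<eta> x xhat"
    and g: "\<forall>i<k. b - A (x i) \<noteq> 0"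
  shows "holder_factor \<nu> *
        (real k powr ((1 + 3 * \<nu>) / (1 + \<nu>)) * \<epsilon> powr ((1 - \<nu>) / (1 + \<nu>))) /
        (2 powr ((1 + 3 * \<nu>) / (1 + \<nu>)) * M powr (2 / (1 + \<nu>))) \<le> Acc k"
proof (cases "M = 0")
  \<comment> \<open>The denominator vanishes for \<open>M = 0\<close>, so division by zero makes the
    claimed bound 0.\<close>
  case True
  then show ?thesis using Acc_nonneg [OF assms(1,2) run \<open>k \<le> N\<close>] by simp
next
  case False
  define p where "p = (1 - \<nu>) / (1 + \<nu>)"
  define c where "c = holder_factor \<nu> * \<epsilon> powr p / M powr (2 / (1 + \<nu>))"
  define q where "q = 2 - p"
  have q: "(1 + 3 * \<nu>) / (1 + \<nu>) = q" "0 < q"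
    using assms(5,6) by (auto simp: p_def q_def field_simps)
  have c: "0 \<le> c"
    by (simp add: c_def holder_factor_def)
  have grow: "real j * (c powr (1 / q) / 2) \<le> Acc j powr (1 / q)" if "j \<le> k" for j
    using that
  proof (induction j)
    case (Suc j)
    have "Acc j powr (1 / q) + c powr (1 / q) / 2 \<le> Acc (Suc j) powr (1 / q)"
      unfolding q_def p_def c_def
      by (rule weight_growth [OF assms(1,2) _ assms(5,6) _ assms(8) run])
         (use Suc.prems assms False g in auto)
    with Suc show ?case
      by (simp add: algebra_simps)
  qed simp
  have "(real k * (c powr (1 / q) / 2)) powr q \<le> (Acc k powr (1 / q)) powr q"
    using grow [of k] q(2) by (intro powr_mono2) auto
  then have "real k powr q * c / 2 powr q \<le> Acc k"
    using q(2) c Acc_nonneg [OF assms(1,2) run \<open>k \<le> N\<close>]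
    by (simp add: powr_mult powr_divide powr_powr)
  then show ?thesis
    unfolding q(1) by (simp add: c_def p_def mult_ac)
qed

theorem theorem3p7:
  fixes f :: "'e::euclidean_space \<Rightarrow> real" and Q :: "'e set"
    and A :: "'e \<Rightarrow> 'h::euclidean_space" and b :: 'h
    and \<epsilon> \<nu> M R :: real and lopt :: 'h and N :: nat
    and \<beta> h a Acc :: "nat \<Rightarrow> real" and l \<zeta> \<eta> :: "nat \<Rightarrow> 'h" and x xhat :: "nat \<Rightarrow> 'e"
  assumes "closed Q" and "convex Q" and "convex_on Q f" and "linear A"
    and "0 \<le> \<nu>" and "\<nu> \<le> 1" and "0 \<le> M"
    and "holder_subgradient f Q A b \<nu> M"
    and "is_arg_min (dual_obj f Q A b) (\<lambda>_. True) lopt"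
    and "norm lopt \<le> R" and "0 < R"
    and "0 < \<epsilon>"
    and "pdugdsdr f Q A b \<epsilon> N \<beta> h a Acc l \<zeta> \<eta> x xhat"
  shows "\<forall>k. 1 \<le> k \<and> k \<le> N \<longrightarrow>
    norm (A (xhat k) - b) \<le> 2 * R / Acc k + \<epsilon> / (2 * R) \<and>
    \<bar>dual_obj f Q A b (\<eta> k) + f (xhat k)\<bar> \<le> 2 * R\<^sup>2 / Acc k + \<epsilon> / 2 \<and>
    ((\<forall>i<k. b - A (x i) \<noteq> 0) \<longrightarrow>
      Acc k \<ge> holder_factor \<nu> *
        (real k powr ((1 + 3 * \<nu>) / (1 + \<nu>)) * \<epsilon> powr ((1 - \<nu>) / (1 + \<nu>))) /
        (2 powr ((1 + 3 * \<nu>) / (1 + \<nu>)) * M powr (2 / (1 + \<nu>))))"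
proof (intro allI impI conjI)
  fix k assume k: "1 \<le> k \<and> k \<le> N"
  \<comment> \<open>The Hoelder hypothesis includes solvability of the inner problem at every
    multiplier, in particular at \<open>lopt\<close>.\<close>
  obtain y where y: "inner_solution f Q A lopt y"
    using assms(8) unfolding holder_subgradient_def by blast
  have opt: "dual_obj f Q A b lopt \<le> dual_obj f Q A b m" for m
    using assms(9) by (auto simp: is_arg_min_def not_less)
  note bounds = primal_dual_bounds [OF assms(4,12,2,3) _ _ assms(13) y opt assms(10,11), of k]
  show "norm (A (xhat k) - b) \<le> 2 * R / Acc k + \<epsilon> / (2 * R)"
    and "\<bar>dual_obj f Q A b (\<eta> k) + f (xhat k)\<bar> \<le> 2 * R\<^sup>2 / Acc k + \<epsilon> / 2"
    using bounds k by auto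
  assume g: "\<forall>i<k. b - A (x i) \<noteq> 0"
  show "holder_factor \<nu> *
        (real k powr ((1 + 3 * \<nu>) / (1 + \<nu>)) * \<epsilon> powr ((1 - \<nu>) / (1 + \<nu>))) /
        (2 powr ((1 + 3 * \<nu>) / (1 + \<nu>)) * M powr (2 / (1 + \<nu>))) \<le> Acc k"
    using k by (intro weight_lower_bound [OF assms(4,12) _ _ assms(5-8,13) g]) auto
qed

end
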